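(* Let $(a,b),(c,d)\in Z(\mathbb{S})$ be such that $(a,b)(c,d)=0$ and $n(a)=n(b)=n(c)=n(d)=1$. Let $C$ denote the connected component of $\Gamma_O(\mathbb{S})$ which contains $(a,b)$. Then the vertex set of $C$ is $P(\Lambda_{(a,b)})$.
   Context: Cayley-Dickson conventions. Let $\mathcal{M}_0=\mathbb{R}$ with trivial involution, and let $\mathcal{M}_{n+1}=\mathcal{M}_n\times\mathcal{M}_n$ with componentwise real vector space structure, product $(a,b)(c,d)=(ac-\bar d b,\ da+b\bar c)$ and involution $\overline{(a,b)}=(\bar a,-b)$. The octonions are $\mathbb{O}=\mathcal{M}_3$ and the sedenions are $\mathbb{S}=\mathcal{M}_4$, so a sedenion is a pair of octonions. The norm is $n(x)=x\bar x=\bar x x\in\mathbb{R}$ (no square root). $Z(\mathbb{S})$ denotes the set of zero divisors, i.e. nonzero $u\in\mathbb{S}$ for which there is a nonzero $v\in\mathbb{S}$ with $uv=0$ or $vu=0$ (in $\mathbb{S}$, $uv=0$ if and only if $vu=0$). For a set $X$ of elements, $P(X)=\{[x]=\mathbb{R}x\mid x\in X\}$. The orthogonality graph $\Gamma_O(\mathbb{S})$ is the undirected graph with vertex set $P(Z(\mathbb{S}))$ in which distinct vertices $[u],[v]$ are adjacent iff $uv=vu=0$; a nonzero element $u$ is identified with the vertex $[u]$. $\mathrm{Lin}^*(u_1,\dots,u_m)$ is the real linear span of $u_1,\dots,u_m$ with $0$ removed. For $(a,b),(c,d)$ as in the claim, $$\Lambda^+_{(a,b)}=\mathrm{Lin}^*((a,b),(b,-a),(d,c),(c,-d),(ac,ad),(ad,-ac)),$$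 $$\Lambda^-_{(a,b)}=\mathrm{Lin}^*((b,a),(a,-b),(c,d),(d,-c),(ad,ac),(ac,-ad)),$$ $$\Lambda_{(a,b)}=\Lambda^+_{(a,b)}\cup\Lambda^-_{(a,b)}.$$ *)

theory Defs
  imports "HOL-Analysis.Product_Vector" "Graph_Theory.Digraph_Component"
begin

section \<open>The Cayley--Dickson process\<close>

text \<open>
  One doubling step: from the product \<open>m\<close> and the involution \<open>j\<close> of an algebra on \<open>'a\<close> to those
  of the algebra on \<open>'a \<times> 'a\<close>. The real vector space structure on pairs is the library's
  componentwise one.
\<close>

definition cd_mult :: "('a \<Rightarrow> 'a \<Rightarrow> 'a) \<Rightarrow> ('a \<Rightarrow> 'a) \<Rightarrow> 'a \<times> 'a \<Rightarrow> 'a \<times> 'a \<Rightarrow> 'a \<times> 'a::real_vector"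
  where "cd_mult m j = (\<lambda>(a, b) (c, d). (m a c - m (j d) b, m d a + m b (j c)))"

definition cd_cnj :: "('a \<Rightarrow> 'a) \<Rightarrow> 'a \<times> 'a \<Rightarrow> 'a \<times> 'a::real_vector"
  where "cd_cnj j = (\<lambda>(a, b). (j a, - b))"

type_synonym cd1 = "real \<times> real"
type_synonym cd2 = "cd1 \<times> cd1"
type_synonym octonion = "cd2 \<times> cd2"
type_synonym sedenion = "octonion \<times> octonion"

definition mult1 :: "cd1 \<Rightarrow> cd1 \<Rightarrow> cd1" where "mult1 = cd_mult (*) id"
definition cnj1 :: "cd1 \<Rightarrow> cd1" where "cnj1 = cd_cnj id"

definition mult2 :: "cd2 \<Rightarrow> cd2 \<Rightarrow> cd2" where "mult2 = cd_mult mult1 cnj1"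
definition cnj2 :: "cd2 \<Rightarrow> cd2" where "cnj2 = cd_cnj cnj1"

definition oct_mult :: "octonion \<Rightarrow> octonion \<Rightarrow> octonion" (infixl \<open>\<cdot>\<^sub>O\<close> 70)
  where "oct_mult = cd_mult mult2 cnj2"
definition oct_cnj :: "octonion \<Rightarrow> octonion" where "oct_cnj = cd_cnj cnj2"

definition sed_mult :: "sedenion \<Rightarrow> sedenion \<Rightarrow> sedenion" (infixl \<open>\<cdot>\<^sub>S\<close> 70)
  where "sed_mult = cd_mult oct_mult oct_cnj"

definition oct_of_real :: "real \<Rightarrow> octonion"
  where "oct_of_real r = (((r, 0), 0), 0)"

text \<open>
  \<open>oct_norm x\<close> is the real number \<open>x x\<^sup>*\<close>, without a square root; it is not the library's
  \<^const>\<open>norm\<close> on products. The description is justified by the lemma that follows.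
\<close>

definition oct_norm :: "octonion \<Rightarrow> real"
  where "oct_norm x = (THE r. x \<cdot>\<^sub>O oct_cnj x = oct_of_real r)"

lemma oct_norm:
  "x \<cdot>\<^sub>O oct_cnj x = oct_of_real (oct_norm x)"
  "oct_cnj x \<cdot>\<^sub>O x = oct_of_real (oct_norm x)"
proof -
  have ex: "\<exists>r. x \<cdot>\<^sub>O oct_cnj x = oct_of_real r \<and> oct_cnj x \<cdot>\<^sub>O x = oct_of_real r"
    by (auto simp: oct_mult_def oct_cnj_def mult2_def cnj2_def mult1_def cnj1_def cd_mult_def
        cd_cnj_def oct_of_real_def zero_prod_def algebra_simps split: prod.splits)
  then obtain r where r: "x \<cdot>\<^sub>O oct_cnj x = oct_of_real r" "oct_cnj x \<cdot>\<^sub>O x = oct_of_real r"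
    by blast
  have "oct_norm x = r"
    unfolding oct_norm_def by (rule the_equality) (use r in \<open>auto simp: oct_of_real_def\<close>)
  with r show "x \<cdot>\<^sub>O oct_cnj x = oct_of_real (oct_norm x)"
    "oct_cnj x \<cdot>\<^sub>O x = oct_of_real (oct_norm x)" by simp_all
qed

section \<open>The orthogonality graph of the sedenions\<close>

definition sed_zero_divisors :: "sedenion set"
  where "sed_zero_divisors = {u. u \<noteq> 0 \<and> (\<exists>v. v \<noteq> 0 \<and> (u \<cdot>\<^sub>S v = 0 \<or> v \<cdot>\<^sub>S u = 0))}"

definition line :: "'a::real_vector \<Rightarrow> 'a set"
  where "line x = range (\<lambda>r. r *\<^sub>R x)"

definition projectivization :: "'a::real_vector set \<Rightarrow> 'a set set"
  where "projectivization X = line ` X"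

text \<open>
  An undirected edge is represented by the two arcs joining its end points. Orthogonality of lines
  does not depend on the chosen representatives.
\<close>

definition orthogonality_graph :: "sedenion set pair_pre_digraph"
  where "orthogonality_graph =
    \<lparr> pverts = projectivization sed_zero_divisors,
      parcs = {(line u, line v) | u v. u \<in> sed_zero_divisors \<and> v \<in> sed_zero_divisors \<and>
        line u \<noteq> line v \<and> u \<cdot>\<^sub>S v = 0 \<and> v \<cdot>\<^sub>S u = 0} \<rparr>"

lemma wf_orthogonality_graph: "wf_digraph (with_proj orthogonality_graph)"
  by unfold_locales (auto simp: orthogonality_graph_def projectivization_def)

lemma symmetric_orthogonality_graph: "symmetric (with_proj orthogonality_graph)"
  unfolding symmetric_def by (rule symI) (simp add: orthogonality_graph_def, metis)

text \<open>
  The qualified \<^const>\<open>Digraph_Component.connected\<close> is connectedness of the underlying undirected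
  graph; the unqualified name could also mean the topological notion.
\<close>

definition connected_component ::
    "('v, 'e) pre_digraph \<Rightarrow> ('v, 'e) pre_digraph \<Rightarrow> bool"
  where "connected_component G C \<longleftrightarrow> pre_digraph.max_subgraph G Digraph_Component.connected C"

lemma ex1_connected_component:
  assumes wf: "wf_digraph G" and sym: "symmetric G" and v: "v \<in> verts G"
  shows "\<exists>!C. connected_component G C \<and> v \<in> verts C"
proof -
  interpret wf_digraph G by (rule wf)
  define S where "S = {w. v \<rightarrow>\<^sup>*\<^bsub>G\<^esub> w}"
  define H where "H = G \<restriction> S"
  have SG: "S \<subseteq> verts G" by (auto simp: S_def dest: reachable_in_verts)
  have vS: "v \<in> S" using v by (auto simp: S_def)
  have indH: "induced_subgraph H G" unfolding H_def using SG by (rule induced_induce)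
  have subH: "subgraph H G" using indH by (rule induced_imp_subgraph)
  interpret H: wf_digraph H unfolding H_def by (rule wellformed_induce_subgraph)
  have symH: "symmetric H" by (rule induced_graph_imp_symmetric[OF sym indH])
  have reachH: "v \<rightarrow>\<^sup>*\<^bsub>H\<^esub> w" if "w \<in> S" for w
    using induce_reachable_preserves_paths[of v w] that by (simp add: H_def S_def)
  have connH: "Digraph_Component.connected H"
    unfolding Digraph_Component.connected_def strongly_connected_def
  proof (intro conjI ballI)
    show "verts (with_proj (mk_symmetric H)) \<noteq> {}" using vS by (auto simp: H_def)
    fix u w assume "u \<in> verts (with_proj (mk_symmetric H))" "w \<in> verts (with_proj (mk_symmetric H))"
    then have "u \<in> S" "w \<in> S" by (simp_all add: H_def)
    then have "u \<rightarrow>\<^sup>*\<^bsub>H\<^esub> w"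
      using symmetric_reachable[OF symH reachH] reachH H.reachable_trans by blast
    then show "u \<rightarrow>\<^sup>*\<^bsub>mk_symmetric H\<^esub> w" by (rule H.reachable_mk_symmetricI)
  qed
  have le: "subgraph K H"
    if K: "subgraph K G" "Digraph_Component.connected K" "v \<in> verts K" for K
  proof -
    have wfK: "wf_digraph K" and comp: "compatible G K" and arcs: "arcs K \<subseteq> arcs G"
      using K(1) by (auto simp: subgraph_def)
    have "verts K \<subseteq> S"
    proof
      fix w assume "w \<in> verts K"
      then have "v \<rightarrow>\<^sup>*\<^bsub>mk_symmetric K\<^esub> w"
        using K by (auto simp: Digraph_Component.connected_def strongly_connected_def)
      then have "v \<rightarrow>\<^sup>*\<^bsub>mk_symmetric G\<^esub> w"
        using subgraph_mk_symmetric[OF K(1)] by (rule pre_digraph.reachable_mono)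
      then show "w \<in> S" using reachable_mk_symmetric_eq[OF sym] by (simp add: S_def)
    qed
    moreover have "tail G e \<in> verts K \<and> head G e \<in> verts K" if "e \<in> arcs K" for e
      using wf_digraph.wellformed[OF wfK that] comp by (simp add: compatible_def)
    ultimately show ?thesis
      unfolding subgraph_def using wfK H.wf_digraph_axioms arcs comp
      by (auto simp: H_def compatible_def)
  qed
  have antisym: "K = H" if "subgraph K H" "subgraph H K" for K
    using that by (intro pre_digraph.equality) (auto simp: subgraph_def compatible_def)
  show ?thesis
  proof (rule ex1I[of _ H])
    have "K = H" if "subgraph H K" "subgraph K G" "Digraph_Component.connected K" for K
      using that le[of K] antisym[of K] vS by (auto simp: subgraph_def H_def)
    then show "connected_component G H \<and> v \<in> verts H"
      using subH connH vS by (auto simp: connected_component_def max_subgraph_def H_def)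
    fix K assume "connected_component G K \<and> v \<in> verts K"
    then show "K = H"
      using le[of K] subH connH by (auto simp: connected_component_def max_subgraph_def)
  qed
qed

section \<open>The sets \<open>\<Lambda>\<close>\<close>

definition lin_star :: "'a::real_vector set \<Rightarrow> 'a set"
  where "lin_star X = span X - {0}"

definition Lambda_plus :: "octonion \<Rightarrow> octonion \<Rightarrow> octonion \<Rightarrow> octonion \<Rightarrow> sedenion set"
  where "Lambda_plus a b c d = lin_star
    {(a, b), (b, - a), (d, c), (c, - d), (a \<cdot>\<^sub>O c, a \<cdot>\<^sub>O d), (a \<cdot>\<^sub>O d, - (a \<cdot>\<^sub>O c))}"

definition Lambda_minus :: "octonion \<Rightarrow> octonion \<Rightarrow> octonion \<Rightarrow> octonion \<Rightarrow> sedenion set"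
  where "Lambda_minus a b c d = lin_star
    {(b, a), (a, - b), (c, d), (d, - c), (a \<cdot>\<^sub>O d, a \<cdot>\<^sub>O c), (a \<cdot>\<^sub>O c, - (a \<cdot>\<^sub>O d))}"

definition Lambda :: "octonion \<Rightarrow> octonion \<Rightarrow> octonion \<Rightarrow> octonion \<Rightarrow> sedenion set"
  where "Lambda a b c d = Lambda_plus a b c d \<union> Lambda_minus a b c d"

end

theory Submission
  imports Defs "HOL-Analysis.Linear_Algebra"
begin

text \<open>
  Put \<open>e = b a\<inverse>\<close>. The vanishing of \<open>(a, b) (c, d)\<close> together with the equality of norms forces \<open>a\<close> and
  \<open>b\<close> to be imaginary and orthogonal, so \<open>e\<close> is an imaginary unit and \<open>(a, b) = (a, e a)\<close> with \<open>a\<close> in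
  the orthogonal complement \<open>V\<close> of \<open>1\<close> and \<open>e\<close>. Left multiplication by \<open>e\<close> turns \<open>V\<close> into a Hermitian
  space of complex dimension three. Two observations carry the proof.

  First, for a nonzero \<open>x\<close> in \<open>V\<close> the sedenions annihilated by \<open>(x, e x)\<close> are exactly the pairs
  \<open>(p, - e p)\<close> with \<open>p\<close> in \<open>V\<close> orthogonal to \<open>x\<close> and \<open>e x\<close>, that is, orthogonal to \<open>x\<close> in the Hermitian
  sense (\<open>right_annihilator_twisted\<close> and \<open>twisted_mult_eq_0\<close>). Hence an edge of the graph replaces
  \<open>e\<close> by \<open>- e\<close>, and the component of \<open>(a, b)\<close> stays among the lines of the pairs \<open>(x, e x)\<close>
  and \<open>(x, - e x)\<close>. Since any two vectors of \<open>V\<close> have a common Hermitian-orthogonal vector, two or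
  three edges lead from \<open>(a, b)\<close> to any of these lines (\<open>reachable_twisted_pairs\<close>).

  Second, \<open>(c, d) = (c, - e c)\<close> with \<open>c\<close> orthogonal to \<open>a\<close> and \<open>e a\<close>, so that \<open>a\<close>, \<open>c\<close> and \<open>a c\<close>
  form a unitary basis of \<open>V\<close>. Therefore \<open>\<Lambda>\<^sup>+\<close> and \<open>\<Lambda>\<^sup>-\<close> consist of the nonzero pairs \<open>(x, e x)\<close>
  and \<open>(x, - e x)\<close> with \<open>x\<close> in \<open>V\<close> (\<open>Lambda_eq_twisted_pairs\<close>).
\<close>

section \<open>The octonions as a composition algebra\<close>

lemmas oct_unfold = oct_mult_def oct_cnj_def mult2_def cnj2_def mult1_def cnj1_def cd_mult_def cd_cnj_def oct_of_real_def

abbreviation one_O :: octonion (\<open>\<one>\<^sub>O\<close>) where "\<one>\<^sub>O \<equiv> oct_of_real 1"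

lemma oct_coordinates:
  obtains a b c d e f g h where "x = ((((a, b), (c, d)), ((e, f), (g, h))) :: octonion)"
  by (metis surj_pair)

text \<open>
  Coordinates are used only for the basic laws of a composition algebra: bilinearity, the unit,
  conjugation, the adjoints of the multiplication maps, cancellation and flexibility. The geometry of
  the octonions used later follows from these laws formally.
\<close>

lemma oct_mult_adjoint_left: "(x \<cdot>\<^sub>O y) \<bullet> z = y \<bullet> (oct_cnj x \<cdot>\<^sub>O z)"
  by (cases x rule: oct_coordinates; cases y rule: oct_coordinates; cases z rule: oct_coordinates;
     hypsubst; simp add: oct_unfold inner_prod_def algebra_simps)

lemma oct_mult_adjoint_right: "(x \<cdot>\<^sub>O y) \<bullet> z = x \<bullet> (z \<cdot>\<^sub>O oct_cnj y)"
  by (cases x rule: oct_coordinates; cases y rule: oct_coordinates; cases z rule: oct_coordinates;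
     hypsubst; simp add: oct_unfold inner_prod_def algebra_simps)

lemma oct_cancel_left: "oct_cnj x \<cdot>\<^sub>O (x \<cdot>\<^sub>O y) = (x \<bullet> x) *\<^sub>R y"
  by (cases x rule: oct_coordinates; cases y rule: oct_coordinates;
     hypsubst; simp add: oct_unfold inner_prod_def algebra_simps)

lemma oct_cancel_right: "(y \<cdot>\<^sub>O x) \<cdot>\<^sub>O oct_cnj x = (x \<bullet> x) *\<^sub>R y"
  by (cases x rule: oct_coordinates; cases y rule: oct_coordinates;
     hypsubst; simp add: oct_unfold inner_prod_def algebra_simps)

lemma oct_cnj_mult: "oct_cnj (x \<cdot>\<^sub>O y) = oct_cnj y \<cdot>\<^sub>O oct_cnj x"
  by (cases x rule: oct_coordinates; cases y rule: oct_coordinates;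
     hypsubst; simp add: oct_unfold inner_prod_def algebra_simps)

lemma oct_flexible: "(x \<cdot>\<^sub>O y) \<cdot>\<^sub>O x = x \<cdot>\<^sub>O (y \<cdot>\<^sub>O x)"
  by (cases x rule: oct_coordinates; cases y rule: oct_coordinates;
     hypsubst; simp add: oct_unfold inner_prod_def algebra_simps)

lemma oct_cnj_eq: "oct_cnj x = (2 * (x \<bullet> \<one>\<^sub>O)) *\<^sub>R \<one>\<^sub>O - x"
  by (cases x rule: oct_coordinates;
     hypsubst; simp add: oct_unfold inner_prod_def zero_prod_def algebra_simps)

lemma oct_cnj_cnj [simp]: "oct_cnj (oct_cnj x) = x"
  by (simp add: oct_cnj_def cnj2_def cnj1_def cd_cnj_def split: prod.splits)

lemma bilinear_oct_mult: "bilinear oct_mult"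
  unfolding bilinear_def
proof (intro conjI allI linearI)
  fix x y z :: octonion and r :: real
  show "x \<cdot>\<^sub>O (y + z) = x \<cdot>\<^sub>O y + x \<cdot>\<^sub>O z" "(y + z) \<cdot>\<^sub>O x = y \<cdot>\<^sub>O x + z \<cdot>\<^sub>O x"
    by (cases x rule: oct_coordinates; cases y rule: oct_coordinates; cases z rule: oct_coordinates;
     hypsubst; simp add: oct_unfold algebra_simps)+
  show "x \<cdot>\<^sub>O (r *\<^sub>R y) = r *\<^sub>R (x \<cdot>\<^sub>O y)"  "(r *\<^sub>R y) \<cdot>\<^sub>O x = r *\<^sub>R (y \<cdot>\<^sub>O x)"
    by (cases x rule: oct_coordinates; cases y rule: oct_coordinates;
     hypsubst; simp add: oct_unfold algebra_simps)+
qed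

lemma oct_one: "\<one>\<^sub>O \<cdot>\<^sub>O x = x" "x \<cdot>\<^sub>O \<one>\<^sub>O = x"
  by (cases x rule: oct_coordinates; hypsubst; simp add: oct_unfold zero_prod_def)+

interpretation oct: bounded_bilinear "(\<cdot>\<^sub>O)"
  using bilinear_oct_mult bilinear_conv_bounded_bilinear by blast

lemma inner_oct_mult_left: "(x \<cdot>\<^sub>O y) \<bullet> (x \<cdot>\<^sub>O z) = (x \<bullet> x) * (y \<bullet> z)"
  by (simp add: oct_mult_adjoint_left oct_cancel_left)

lemma inner_oct_mult_right: "(y \<cdot>\<^sub>O x) \<bullet> (z \<cdot>\<^sub>O x) = (x \<bullet> x) * (y \<bullet> z)"
  by (simp add: oct_mult_adjoint_right oct_cancel_right)

lemma inner_oct_one [simp]: "\<one>\<^sub>O \<bullet> \<one>\<^sub>O = 1"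
  by (simp add: oct_of_real_def inner_prod_def)

lemma oct_norm_eq_inner: "oct_norm x = x \<bullet> x"
proof -
  have "oct_of_real (oct_norm x) = (x \<bullet> x) *\<^sub>R \<one>\<^sub>O"
    using oct_norm(1)[of x] oct_cancel_right[of "\<one>\<^sub>O" x] by (simp add: oct_one)
  then show ?thesis by (simp add: oct_of_real_def)
qed

lemma oct_cnj_inner_one [simp]: "oct_cnj x \<bullet> \<one>\<^sub>O = x \<bullet> \<one>\<^sub>O"
  by (simp add: oct_cnj_eq inner_diff_left)

lemma oct_cnj_imaginary: "x \<bullet> \<one>\<^sub>O = 0 \<Longrightarrow> oct_cnj x = - x"
  by (simp add: oct_cnj_eq)

text \<open>
  Polarizing the cancellation laws gives the Clifford relations: orthogonal imaginary octonions
  anticommute, and so do the left multiplications and the right multiplications by them. In the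
  absence of associativity these relations are what moves factors past each other below.
\<close>

lemma oct_polar_left:
  "oct_cnj x \<cdot>\<^sub>O (y \<cdot>\<^sub>O z) + oct_cnj y \<cdot>\<^sub>O (x \<cdot>\<^sub>O z) = (2 * (x \<bullet> y)) *\<^sub>R z"
proof -
  have "oct_cnj (x + y) \<cdot>\<^sub>O ((x + y) \<cdot>\<^sub>O z) = ((x + y) \<bullet> (x + y)) *\<^sub>R z"
    by (rule oct_cancel_left)
  moreover have "oct_cnj (x + y) = oct_cnj x + oct_cnj y"
    by (simp add: oct_cnj_eq inner_add_left algebra_simps)
  ultimately show ?thesis
    by (simp add: oct.add_left oct.add_right oct_cancel_left inner_add_left inner_add_right
        inner_commute algebra_simps)
qed

lemma oct_polar_right:
  "(z \<cdot>\<^sub>O x) \<cdot>\<^sub>O oct_cnj y + (z \<cdot>\<^sub>O y) \<cdot>\<^sub>O oct_cnj x = (2 * (x \<bullet> y)) *\<^sub>R z"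
proof -
  have "(z \<cdot>\<^sub>O (x + y)) \<cdot>\<^sub>O oct_cnj (x + y) = ((x + y) \<bullet> (x + y)) *\<^sub>R z"
    by (rule oct_cancel_right)
  moreover have "oct_cnj (x + y) = oct_cnj x + oct_cnj y"
    by (simp add: oct_cnj_eq inner_add_left algebra_simps)
  ultimately show ?thesis
    by (simp add: oct.add_left oct.add_right oct_cancel_right inner_add_left inner_add_right
        inner_commute algebra_simps)
qed

lemma oct_anticommute:
  assumes "x \<bullet> \<one>\<^sub>O = 0" "y \<bullet> \<one>\<^sub>O = 0" "x \<bullet> y = 0"
  shows oct_anticommute_left: "x \<cdot>\<^sub>O (y \<cdot>\<^sub>O z) = - (y \<cdot>\<^sub>O (x \<cdot>\<^sub>O z))"
    and oct_anticommute_right: "(z \<cdot>\<^sub>O x) \<cdot>\<^sub>O y = - ((z \<cdot>\<^sub>O y) \<cdot>\<^sub>O x)"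
    and oct_anticommute_plain: "x \<cdot>\<^sub>O y = - (y \<cdot>\<^sub>O x)"
proof -
  show l: "x \<cdot>\<^sub>O (y \<cdot>\<^sub>O z) = - (y \<cdot>\<^sub>O (x \<cdot>\<^sub>O z))" for z
    using oct_polar_left[of x y z] assms
    by (simp add: oct_cnj_imaginary oct.minus_left neg_eq_iff_add_eq_0 eq_neg_iff_add_eq_0)
  show "(z \<cdot>\<^sub>O x) \<cdot>\<^sub>O y = - ((z \<cdot>\<^sub>O y) \<cdot>\<^sub>O x)"
    using oct_polar_right[of z x y] assms
    by (simp add: oct_cnj_imaginary oct.minus_right neg_eq_iff_add_eq_0 eq_neg_iff_add_eq_0)
  show "x \<cdot>\<^sub>O y = - (y \<cdot>\<^sub>O x)"
    using l[of "\<one>\<^sub>O"] by (simp add: oct_one)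
qed

lemma oct_imaginary_square:
  assumes "x \<bullet> \<one>\<^sub>O = 0"
  shows oct_imaginary_square_left: "x \<cdot>\<^sub>O (x \<cdot>\<^sub>O y) = - ((x \<bullet> x) *\<^sub>R y)"
    and oct_imaginary_square_right: "(y \<cdot>\<^sub>O x) \<cdot>\<^sub>O x = - ((x \<bullet> x) *\<^sub>R y)"
    and oct_imaginary_square_plain: "x \<cdot>\<^sub>O x = - ((x \<bullet> x) *\<^sub>R \<one>\<^sub>O)"
proof -
  show l: "x \<cdot>\<^sub>O (x \<cdot>\<^sub>O y) = - ((x \<bullet> x) *\<^sub>R y)" for y
    using oct_cancel_left[of x y] assms by (metis oct_cnj_imaginary oct.minus_left minus_minus)
  show "(y \<cdot>\<^sub>O x) \<cdot>\<^sub>O x = - ((x \<bullet> x) *\<^sub>R y)"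
    using oct_cancel_right[of y x] assms by (metis oct_cnj_imaginary oct.minus_right minus_minus)
  show "x \<cdot>\<^sub>O x = - ((x \<bullet> x) *\<^sub>R \<one>\<^sub>O)"
    using l[of "\<one>\<^sub>O"] by (simp add: oct_one)
qed

section \<open>Products of sedenions that vanish\<close>

lemma sed_mult_eq_0_iff:
  "(a, b) \<cdot>\<^sub>S (c, d) = 0 \<longleftrightarrow>
     a \<cdot>\<^sub>O c = oct_cnj d \<cdot>\<^sub>O b \<and> d \<cdot>\<^sub>O a = - (b \<cdot>\<^sub>O oct_cnj c)"
  by (simp add: sed_mult_def cd_mult_def prod_eq_iff add_eq_0_iff2)

text \<open>
  Each of the two octonion equations behind a vanishing product can be solved for \<open>d\<close>, the first one if
  \<open>b\<close> and the second one if \<open>a\<close> is nonzero; the comparison of the two values is the source of all constraints on \<open>a\<close>, \<open>b\<close> and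
  \<open>c\<close>.
\<close>

lemma sed_mult_eq_0D:
  assumes "(a, b) \<cdot>\<^sub>S (c, d) = 0"
  shows "(b \<bullet> b) *\<^sub>R d = b \<cdot>\<^sub>O (oct_cnj c \<cdot>\<^sub>O oct_cnj a)"
    and "(a \<bullet> a) *\<^sub>R d = - ((b \<cdot>\<^sub>O oct_cnj c) \<cdot>\<^sub>O oct_cnj a)"
proof -
  have 1: "oct_cnj c \<cdot>\<^sub>O oct_cnj a = oct_cnj b \<cdot>\<^sub>O d" and 2: "d \<cdot>\<^sub>O a = - (b \<cdot>\<^sub>O oct_cnj c)"
    using assms by (metis sed_mult_eq_0_iff oct_cnj_mult oct_cnj_cnj)+
  have "oct_cnj b \<bullet> oct_cnj b = b \<bullet> b"
    by (simp add: oct_cnj_eq inner_diff_left inner_diff_right inner_commute)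
  then show "(b \<bullet> b) *\<^sub>R d = b \<cdot>\<^sub>O (oct_cnj c \<cdot>\<^sub>O oct_cnj a)"
    using oct_cancel_left[of "oct_cnj b" d] by (simp add: 1)
  show "(a \<bullet> a) *\<^sub>R d = - ((b \<cdot>\<^sub>O oct_cnj c) \<cdot>\<^sub>O oct_cnj a)"
    using oct_cancel_right[of d a] by (simp add: 2 oct.minus_left)
qed

text \<open>
  Write \<open>A = a\<^sup>*\<close> and \<open>r = c\<^sup>*\<close>. When the two components have the same norm, the two values of
  \<open>d\<close> give \<open>b (r A) + (b r) A = 0\<close>. Taking the inner product of this equation with \<open>b r\<close>, with
  \<open>r A\<close> and with \<open>A r A\<close> makes both summands contribute equally, by compatibility of inner product and
  multiplication, and leaves nonzero multiples of the real part of \<open>A\<close>, the real part of \<open>b\<close>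
  and \<open>A \<bullet> b\<close>.
\<close>

lemma sed_zero_divisor_imaginary_orthogonal:
  assumes prod: "(a, b) \<cdot>\<^sub>S (c, d) = 0" and eq: "a \<bullet> a = b \<bullet> b" and nz: "a \<noteq> 0" "c \<noteq> 0"
  shows "a \<bullet> \<one>\<^sub>O = 0" "b \<bullet> \<one>\<^sub>O = 0" "a \<bullet> b = 0"
proof -
  define A r where "A = oct_cnj a" and "r = oct_cnj c"
  have rn: "r \<bullet> r \<noteq> 0"
    using nz oct_cnj_cnj[of c] by (auto simp: r_def oct_cnj_eq)
  have An: "A \<bullet> A \<noteq> 0"
    using nz oct_cnj_cnj[of a] by (auto simp: A_def oct_cnj_eq)
  have bn: "b \<bullet> b \<noteq> 0" using nz eq by (metis inner_eq_zero_iff)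
  have E: "b \<cdot>\<^sub>O (r \<cdot>\<^sub>O A) + (b \<cdot>\<^sub>O r) \<cdot>\<^sub>O A = 0"
    using sed_mult_eq_0D[OF prod] by (simp add: eq A_def r_def)
  have one: "(x \<cdot>\<^sub>O y) \<bullet> x = (x \<bullet> x) * (y \<bullet> \<one>\<^sub>O)" "(x \<cdot>\<^sub>O y) \<bullet> y = (y \<bullet> y) * (x \<bullet> \<one>\<^sub>O)" for x y
    using inner_oct_mult_left[of x y "\<one>\<^sub>O"] inner_oct_mult_right[of x y "\<one>\<^sub>O"] by (simp_all add: oct_one)
  have "(b \<cdot>\<^sub>O (r \<cdot>\<^sub>O A) + (b \<cdot>\<^sub>O r) \<cdot>\<^sub>O A) \<bullet> (b \<cdot>\<^sub>O r) = 2 * (b \<bullet> b) * (r \<bullet> r) * (A \<bullet> \<one>\<^sub>O)"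
    by (simp add: inner_add_left inner_oct_mult_left one)
  then have A1: "A \<bullet> \<one>\<^sub>O = 0" using E rn bn by simp
  then show "a \<bullet> \<one>\<^sub>O = 0" by (simp add: A_def)
  have "(b \<cdot>\<^sub>O (r \<cdot>\<^sub>O A) + (b \<cdot>\<^sub>O r) \<cdot>\<^sub>O A) \<bullet> (r \<cdot>\<^sub>O A) = 2 * (A \<bullet> A) * (r \<bullet> r) * (b \<bullet> \<one>\<^sub>O)"
    by (simp add: inner_add_left inner_oct_mult_right inner_oct_mult_left one)
  then show "b \<bullet> \<one>\<^sub>O = 0" using E rn An by simp
  \<comment> \<open>By flexibility \<open>A (r A) = (A r) A\<close>, so each summand can be paired with the form of this vector
    that shares a factor with it.\<close>
  have "(b \<cdot>\<^sub>O (r \<cdot>\<^sub>O A)) \<bullet> (A \<cdot>\<^sub>O (r \<cdot>\<^sub>O A)) + ((b \<cdot>\<^sub>O r) \<cdot>\<^sub>O A) \<bullet> ((A \<cdot>\<^sub>O r) \<cdot>\<^sub>O A)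
       = 2 * (A \<bullet> A) * (r \<bullet> r) * (A \<bullet> b)"
    by (simp add: inner_oct_mult_right inner_oct_mult_left inner_commute)
  then have "(b \<cdot>\<^sub>O (r \<cdot>\<^sub>O A) + (b \<cdot>\<^sub>O r) \<cdot>\<^sub>O A) \<bullet> (A \<cdot>\<^sub>O (r \<cdot>\<^sub>O A))
       = 2 * (A \<bullet> A) * (r \<bullet> r) * (A \<bullet> b)"
    by (simp add: inner_add_left oct_flexible)
  then have "A \<bullet> b = 0" using E rn An by simp
  moreover have "A = - a" using \<open>a \<bullet> \<one>\<^sub>O = 0\<close> by (simp add: A_def oct_cnj_imaginary)
  ultimately show "a \<bullet> b = 0" by simp
qed

section \<open>Vectors orthogonal to an imaginary unit\<close>

text \<open>
  Listing the vectors lets simplification decide both their pairwise orthogonality and their number;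
  that the list has no repetitions then comes for free.
\<close>

lemma orthonormal_list_expansion:
  fixes us :: "'a::euclidean_space list"
  assumes orth: "sorted_wrt (\<lambda>u v. u \<bullet> v = 0) us" and unit: "\<forall>u\<in>set us. u \<bullet> u = 1"
    and len: "length us = DIM('a)"
  shows "(\<Sum>u\<leftarrow>us. (x \<bullet> u) *\<^sub>R u) = x"
proof -
  have nth: "us ! i \<bullet> us ! j = 0" if "i < length us" "j < length us" "i \<noteq> j" for i j
    using orth that sorted_wrt_nth_less[OF orth, of i j] sorted_wrt_nth_less[OF orth, of j i]
    by (cases i j rule: linorder_cases) (simp_all add: inner_commute)
  have dist: "distinct us"
    unfolding distinct_conv_nth
  proof (intro allI impI notI)
    fix i j assume "i < length us" "j < length us" "i \<noteq> j" "us ! i = us ! j"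
    then show False using nth[of i j] unit nth_mem[of j us] by simp
  qed
  have pw: "pairwise orthogonal (set us)"
    using nth by (fastforce simp: pairwise_def orthogonal_def in_set_conv_nth)
  moreover have "0 \<notin> set us" using unit by auto
  ultimately have ind: "independent (set us)" by (rule pairwise_orthogonal_independent)
  have "UNIV \<subseteq> span (set us)"
    by (rule card_ge_dim_independent[OF _ ind]) (simp_all add: distinct_card[OF dist] len)
  then have span: "span (set us) = UNIV" by auto
  let ?y = "\<Sum>u\<in>set us. (x \<bullet> u) *\<^sub>R u"
  have "?y \<bullet> v = x \<bullet> v" if v: "v \<in> set us" for v
  proof -
    have "?y \<bullet> v = (\<Sum>u\<in>set us. if u = v then x \<bullet> v else 0)"
      unfolding inner_sum_left using pw unit v
      by (intro sum.cong) (auto simp: pairwise_def orthogonal_def)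
    then show ?thesis using v by simp
  qed
  then have perp: "orthogonal (x - ?y) v" if "v \<in> set us" for v
    using that by (simp add: orthogonal_def inner_diff_left)
  have "orthogonal (x - ?y) (x - ?y)"
    by (rule orthogonal_to_span[where S = "set us"]) (simp_all add: span perp)
  then have "?y = x" by (simp add: orthogonal_self)
  then show ?thesis by (simp add: sum_list_distinct_conv_sum_set dist)
qed

text \<open>
  When \<open>e\<close> is an imaginary unit, this is the six-dimensional orthogonal complement of a plane. Left
  multiplication by \<open>e\<close> is then an orthogonal complex structure on it and makes it a Hermitian space
  of complex dimension three.
\<close>

definition perp_plane :: "octonion \<Rightarrow> octonion set"
  where "perp_plane e = {x. x \<bullet> \<one>\<^sub>O = 0 \<and> x \<bullet> e = 0}"

locale imaginary_unit =
  fixes e :: octonion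
  assumes e_one: "e \<bullet> \<one>\<^sub>O = 0" and e_unit: "e \<bullet> e = 1"
begin

lemma unit_mult_unit_mult: "e \<cdot>\<^sub>O (e \<cdot>\<^sub>O x) = - x"
  using oct_imaginary_square_left[OF e_one] by (simp add: e_unit)

lemma inner_unit_mult: "(e \<cdot>\<^sub>O x) \<bullet> (e \<cdot>\<^sub>O y) = x \<bullet> y"
  by (simp add: inner_oct_mult_left e_unit)

lemma inner_unit_mult_skew: "(e \<cdot>\<^sub>O x) \<bullet> y = - (x \<bullet> (e \<cdot>\<^sub>O y))"
  by (simp add: oct_mult_adjoint_left oct_cnj_imaginary[OF e_one] oct.minus_left)

lemma inner_unit_mult_self: "x \<bullet> (e \<cdot>\<^sub>O x) = 0"
  using inner_unit_mult_skew[of x x] by (simp add: inner_commute)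

lemma unit_mult_perp:
  assumes "x \<in> perp_plane e"
  shows "e \<cdot>\<^sub>O x \<in> perp_plane e"
proof -
  have "e \<cdot>\<^sub>O e = - \<one>\<^sub>O" using oct_imaginary_square_plain[OF e_one] by (simp add: e_unit)
  then show ?thesis using assms by (simp add: perp_plane_def inner_unit_mult_skew oct_one)
qed

lemma perp_mult_unit:
  assumes "x \<in> perp_plane e"
  shows "x \<cdot>\<^sub>O (e \<cdot>\<^sub>O y) = - (e \<cdot>\<^sub>O (x \<cdot>\<^sub>O y))" "x \<cdot>\<^sub>O e = - (e \<cdot>\<^sub>O x)"
  using assms e_one
  by (auto simp: perp_plane_def intro!: oct_anticommute_left oct_anticommute_plain)

text \<open>
  With \<open>y = e x\<close> and \<open>r = p\<^sup>*\<close> the two values of \<open>q\<close> give \<open>y (r x) + (y r) x = 0\<close>. Moving the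
  multiplications to the other side of an inner product turns this into
  \<open>r \<bullet> ((y z) x + y (z x)) = 0\<close> for every \<open>z\<close>. For \<open>z\<close> equal to \<open>1\<close>, \<open>x\<close>, \<open>y\<close> and \<open>e\<close> the second factor is a
  nonzero multiple of \<open>e\<close>, \<open>y\<close>, \<open>x\<close> and \<open>1\<close>, so \<open>r\<close> is orthogonal to these four vectors. Then
  \<open>r = - p\<close>, and the Clifford relations evaluate \<open>q\<close>.
\<close>

lemma right_annihilator_twisted:
  assumes x: "x \<in> perp_plane e" "x \<noteq> 0" and prod: "(x, e \<cdot>\<^sub>O x) \<cdot>\<^sub>S (p, q) = 0"
  shows "p \<in> perp_plane e" "p \<bullet> x = 0" "p \<bullet> (e \<cdot>\<^sub>O x) = 0" "q = - (e \<cdot>\<^sub>O p)"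
proof -
  define N y r where "N = x \<bullet> x" and "y = e \<cdot>\<^sub>O x" and "r = oct_cnj p"
  have N: "N \<noteq> 0" "x \<bullet> x = N" "y \<bullet> y = N" using x by (auto simp: N_def y_def inner_unit_mult)
  have x1: "x \<bullet> \<one>\<^sub>O = 0" and y1: "y \<bullet> \<one>\<^sub>O = 0"
    using x(1) unit_mult_perp[OF x(1)] by (auto simp: perp_plane_def y_def)
  have cx: "oct_cnj x = - x" and cy: "oct_cnj y = - y" using x1 y1 by (auto simp: oct_cnj_imaginary)
  have q: "N *\<^sub>R q = - (y \<cdot>\<^sub>O (r \<cdot>\<^sub>O x))" "N *\<^sub>R q = (y \<cdot>\<^sub>O r) \<cdot>\<^sub>O x"
    using sed_mult_eq_0D[OF prod] by (simp_all add: N y_def[symmetric] r_def[symmetric] cx oct.minus_right)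
  have key: "r \<bullet> ((y \<cdot>\<^sub>O z) \<cdot>\<^sub>O x + y \<cdot>\<^sub>O (z \<cdot>\<^sub>O x)) = 0" for z
  proof -
    have "r \<bullet> ((y \<cdot>\<^sub>O z) \<cdot>\<^sub>O x + y \<cdot>\<^sub>O (z \<cdot>\<^sub>O x)) = (y \<cdot>\<^sub>O (r \<cdot>\<^sub>O x) + (y \<cdot>\<^sub>O r) \<cdot>\<^sub>O x) \<bullet> z"
      by (simp add: inner_add_left inner_add_right oct_mult_adjoint_left[of y]
          oct_mult_adjoint_right[of _ x] cx cy oct.minus_left oct.minus_right)
    also have "\<dots> = 0" using q by simp
    finally show ?thesis .
  qed
  have yx: "y \<cdot>\<^sub>O x = - (N *\<^sub>R e)" unfolding y_def using oct_imaginary_square_right[OF x1] by (simp add: N)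
  have ye: "y \<cdot>\<^sub>O e = x"
    using perp_mult_unit(2)[OF unit_mult_perp[OF x(1)]] by (simp add: y_def unit_mult_unit_mult)
  have re: "r \<bullet> e = 0"
    using key[of "\<one>\<^sub>O"] N by (simp add: oct_one yx inner_diff_right)
  have ry: "r \<bullet> y = 0"
    using key[of x] N by (simp add: yx oct_imaginary_square_plain[OF x1] oct.minus_left oct.minus_right
        oct.scaleR_left oct.scaleR_right oct_one y_def[symmetric] inner_diff_right)
  have rx: "r \<bullet> x = 0"
    using key[of y] N by (simp add: oct_imaginary_square_left[OF y1] oct_imaginary_square_plain[OF y1]
        oct.minus_left oct.scaleR_left oct_one inner_diff_right)
  have r1: "r \<bullet> \<one>\<^sub>O = 0"
    using key[of e] N by (simp add: ye y_def[symmetric] oct_imaginary_square_plain[OF x1]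
        oct_imaginary_square_plain[OF y1] inner_diff_right)
  have p1: "p \<bullet> \<one>\<^sub>O = 0" using r1 by (simp add: r_def)
  then have rp: "r = - p" by (simp add: r_def oct_cnj_imaginary)
  show "p \<in> perp_plane e" "p \<bullet> x = 0" "p \<bullet> (e \<cdot>\<^sub>O x) = 0"
    using p1 re rx ry by (simp_all add: rp perp_plane_def y_def)
  have "N *\<^sub>R q = - ((y \<cdot>\<^sub>O p) \<cdot>\<^sub>O x)" using q by (simp add: rp oct.minus_left oct.minus_right)
  also have "\<dots> = (y \<cdot>\<^sub>O x) \<cdot>\<^sub>O p"
    using oct_anticommute_right[OF p1 x1, of y] \<open>p \<bullet> x = 0\<close> by simp
  also have "\<dots> = N *\<^sub>R (- (e \<cdot>\<^sub>O p))" by (simp add: yx oct.minus_left oct.scaleR_left)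
  finally show "q = - (e \<cdot>\<^sub>O p)" using N by (metis scaleR_cancel_left)
qed

text \<open>
  The second component of the product vanishes because right multiplications by \<open>x\<close> and \<open>p\<close>
  anticommute. For the first component put \<open>u = e p\<close>: since \<open>e\<close> anticommutes with \<open>u\<close> and \<open>u\<close> with
  \<open>x\<close>, the product \<open>u (e x)\<close> becomes \<open>e (x (e p))\<close>, and moving the inner \<open>e\<close> past \<open>x\<close> makes the two factors
  \<open>e\<close> cancel.
\<close>

lemma twisted_mult_eq_0:
  assumes x: "x \<in> perp_plane e" and p: "p \<in> perp_plane e"
    and px: "p \<bullet> x = 0" "p \<bullet> (e \<cdot>\<^sub>O x) = 0"
  shows "(x, e \<cdot>\<^sub>O x) \<cdot>\<^sub>S (p, - (e \<cdot>\<^sub>O p)) = 0"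
proof -
  define u where "u = e \<cdot>\<^sub>O p"
  have u: "u \<in> perp_plane e" unfolding u_def by (rule unit_mult_perp[OF p])
  have im: "u \<bullet> \<one>\<^sub>O = 0" "x \<bullet> \<one>\<^sub>O = 0" "p \<bullet> \<one>\<^sub>O = 0" using u x p by (auto simp: perp_plane_def)
  have ux: "u \<bullet> x = 0" using px by (simp add: u_def inner_unit_mult_skew)
  have "u \<cdot>\<^sub>O (e \<cdot>\<^sub>O x) = - (e \<cdot>\<^sub>O (u \<cdot>\<^sub>O x))" by (rule perp_mult_unit[OF u])
  also have "\<dots> = e \<cdot>\<^sub>O (x \<cdot>\<^sub>O u)"
    using oct_anticommute_plain[OF im(1,2) ux] by (simp add: oct.minus_right)
  also have "\<dots> = x \<cdot>\<^sub>O p"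
    by (simp add: u_def perp_mult_unit[OF x] oct.minus_right unit_mult_unit_mult)
  finally have 1: "x \<cdot>\<^sub>O p = u \<cdot>\<^sub>O (e \<cdot>\<^sub>O x)" by simp
  have 2: "u \<cdot>\<^sub>O x = - ((e \<cdot>\<^sub>O x) \<cdot>\<^sub>O p)"
    unfolding u_def by (rule oct_anticommute_right[OF im(3,2) px(1)])
  have "oct_cnj (- u) = u" "oct_cnj p = - p" using im by (simp_all add: oct_cnj_imaginary)
  then show ?thesis
    unfolding sed_mult_eq_0_iff u_def[symmetric] using 1 2 by (simp add: oct.minus_left oct.minus_right)
qed

text \<open>
  Any two vectors of a three-dimensional Hermitian space have a common nonzero orthogonal vector.
  In real terms \<open>z\<close> has to avoid six directions out of eight.
\<close>

lemma perp_exists: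
  obtains z where "z \<in> perp_plane e" "z \<noteq> 0" "z \<bullet> x = 0" "z \<bullet> (e \<cdot>\<^sub>O x) = 0"
    "z \<bullet> y = 0" "z \<bullet> (e \<cdot>\<^sub>O y) = 0"
proof -
  let ?l = "[\<one>\<^sub>O, e, x, e \<cdot>\<^sub>O x, y, e \<cdot>\<^sub>O y]"
  have "dim (span (set ?l)) \<le> card (set ?l)" by (simp add: dim_le_card span_superset)
  also have "\<dots> \<le> length ?l" by (rule card_length)
  also have "\<dots> < dim (UNIV :: octonion set)" by simp
  finally have "span (set ?l) \<noteq> UNIV" by (metis order_less_irrefl)
  then obtain z where "z \<noteq> 0" "\<forall>w\<in>span (set ?l). z \<bullet> w = 0"
    by (rule span_not_UNIV_orthogonal[THEN exE]) auto
  moreover from this(2) have "z \<bullet> w = 0" if "w \<in> set ?l" for w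
    using that by (simp add: span_base)
  ultimately show ?thesis by (intro that[of z]) (auto simp: perp_plane_def)
qed

text \<open>
  The vectors \<open>a\<close>, \<open>c\<close> and \<open>a c\<close> form a unitary basis: orthogonality of \<open>a c\<close> to the other vectors comes
  down, through the adjoint and isometry laws, to that of \<open>a\<close> and \<open>c\<close> to each other and to \<open>1\<close> and \<open>e\<close>.
  Together with \<open>1\<close> and \<open>e\<close> there are eight orthonormal vectors, which is the dimension of the octonions.
\<close>

lemma perp_plane_eq_span:
  assumes a: "a \<in> perp_plane e" "a \<bullet> a = 1" and c: "c \<in> perp_plane e" "c \<bullet> c = 1"
    and ca: "c \<bullet> a = 0" "c \<bullet> (e \<cdot>\<^sub>O a) = 0"
  shows "perp_plane e = span {a, e \<cdot>\<^sub>O a, c, e \<cdot>\<^sub>O c, a \<cdot>\<^sub>O c, e \<cdot>\<^sub>O (a \<cdot>\<^sub>O c)}" (is "_ = span ?S")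
proof
  have ac: "(a \<cdot>\<^sub>O c) \<bullet> \<one>\<^sub>O = 0" "(a \<cdot>\<^sub>O c) \<bullet> e = 0" "(a \<cdot>\<^sub>O c) \<bullet> a = 0" "(a \<cdot>\<^sub>O c) \<bullet> c = 0"
    "(a \<cdot>\<^sub>O c) \<bullet> (e \<cdot>\<^sub>O a) = 0" "(a \<cdot>\<^sub>O c) \<bullet> (e \<cdot>\<^sub>O c) = 0" "(a \<cdot>\<^sub>O c) \<bullet> (a \<cdot>\<^sub>O c) = 1"
  proof -
    have im: "a \<bullet> \<one>\<^sub>O = 0" "c \<bullet> \<one>\<^sub>O = 0" "a \<bullet> e = 0" "c \<bullet> e = 0"
      using a c by (auto simp: perp_plane_def)
    have ea: "e \<cdot>\<^sub>O a = - (a \<cdot>\<^sub>O e)" using perp_mult_unit(2)[OF a(1)] by simp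
    show "(a \<cdot>\<^sub>O c) \<bullet> \<one>\<^sub>O = 0" "(a \<cdot>\<^sub>O c) \<bullet> e = 0"
      using ca by (simp_all add: oct_mult_adjoint_left oct_cnj_imaginary im oct.minus_left oct_one ea)
    show "(a \<cdot>\<^sub>O c) \<bullet> a = 0" "(a \<cdot>\<^sub>O c) \<bullet> c = 0"
      using inner_oct_mult_left[of a c "\<one>\<^sub>O"] inner_oct_mult_right[of a c "\<one>\<^sub>O"] by (simp_all add: im oct_one)
    show "(a \<cdot>\<^sub>O c) \<bullet> (e \<cdot>\<^sub>O a) = 0" "(a \<cdot>\<^sub>O c) \<bullet> (e \<cdot>\<^sub>O c) = 0" "(a \<cdot>\<^sub>O c) \<bullet> (a \<cdot>\<^sub>O c) = 1"
      using a c by (simp_all add: inner_oct_mult_right inner_oct_mult_left ea im)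
  qed
  have "subspace (perp_plane e)"
    by (auto simp: perp_plane_def subspace_def inner_add_left)
  moreover have "?S \<subseteq> perp_plane e"
    using a c ac unit_mult_perp by (auto simp: perp_plane_def)
  ultimately show "span ?S \<subseteq> perp_plane e" by (intro span_minimal)
  show "perp_plane e \<subseteq> span ?S"
  proof
    fix x assume x: "x \<in> perp_plane e"
    let ?l = "[\<one>\<^sub>O, e, a, e \<cdot>\<^sub>O a, c, e \<cdot>\<^sub>O c, a \<cdot>\<^sub>O c, e \<cdot>\<^sub>O (a \<cdot>\<^sub>O c)]"
    have "a \<bullet> (e \<cdot>\<^sub>O c) = 0" "a \<bullet> (e \<cdot>\<^sub>O (a \<cdot>\<^sub>O c)) = 0" "c \<bullet> (e \<cdot>\<^sub>O (a \<cdot>\<^sub>O c)) = 0"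
      using inner_unit_mult_skew[of a c] inner_unit_mult_skew[of a "a \<cdot>\<^sub>O c"]
        inner_unit_mult_skew[of c "a \<cdot>\<^sub>O c"] ca ac by (simp_all add: inner_commute)
    moreover have "e \<cdot>\<^sub>O (a \<cdot>\<^sub>O c) \<in> perp_plane e"
      using ac by (intro unit_mult_perp) (simp add: perp_plane_def)
    ultimately have "sorted_wrt (\<lambda>u v. u \<bullet> v = 0) ?l"
      using a c ca ac e_one unit_mult_perp[OF a(1)] unit_mult_perp[OF c(1)] oct_imaginary_square_plain[OF e_one]
      by (simp add: perp_plane_def inner_commute inner_unit_mult inner_unit_mult_self)
    moreover have "\<forall>u\<in>set ?l. u \<bullet> u = 1"
      using a c ac by (simp add: inner_unit_mult e_unit)
    moreover have "length ?l = DIM(octonion)" by simp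
    ultimately have "(\<Sum>u\<leftarrow>?l. (x \<bullet> u) *\<^sub>R u) = x" by (rule orthonormal_list_expansion)
    \<comment> \<open>The coefficients at \<open>1\<close> and \<open>e\<close> vanish.\<close>
    then have *: "x = (\<Sum>u\<leftarrow>drop 2 ?l. (x \<bullet> u) *\<^sub>R u)" using x by (simp add: perp_plane_def)
    show "x \<in> span ?S"
      by (subst *) (auto intro!: span_add span_scale intro: span_base)
  qed
qed

end

section \<open>Pairs twisted by an imaginary unit\<close>

text \<open>
  For \<open>e = b a\<inverse>\<close> these sets give a description of \<open>\<Lambda>\<close> that no longer mentions the particular vectors
  \<open>a\<close>, \<open>b\<close>, \<open>c\<close> and \<open>d\<close>: its two parts turn out to be the sets for \<open>e\<close> and for \<open>- e\<close>.
\<close>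

definition twisted_pairs :: "octonion \<Rightarrow> sedenion set"
  where "twisted_pairs e = (\<lambda>x. (x, e \<cdot>\<^sub>O x)) ` (perp_plane e - {0})"

lemma twisted_pairsI:
  "x \<in> perp_plane e \<Longrightarrow> x \<noteq> 0 \<Longrightarrow> (x, e \<cdot>\<^sub>O x) \<in> twisted_pairs e"
  unfolding twisted_pairs_def by (rule image_eqI[where x = x]) simp_all

lemma twisted_pairsE:
  assumes "u \<in> twisted_pairs e"
  obtains x where "x \<in> perp_plane e" "x \<noteq> 0" "u = (x, e \<cdot>\<^sub>O x)"
proof -
  obtain x where "u = (x, e \<cdot>\<^sub>O x)" "x \<in> perp_plane e - {0}"
    using assms unfolding twisted_pairs_def by (rule imageE)
  then show ?thesis using that[of x] by simp
qed

lemma mem_line_self: "u \<in> line u"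
  unfolding line_def by (rule range_eqI[of _ _ 1]) simp

lemma mem_lineE:
  assumes "u \<in> line w"
  obtains r where "u = r *\<^sub>R w"
  using assms unfolding line_def by (rule rangeE)

lemma line_in_projectivization: "u \<in> X \<Longrightarrow> line u \<in> projectivization X"
  unfolding projectivization_def by (rule imageI)

lemma perp_plane_uminus [simp]: "perp_plane (- e) = perp_plane e"
  by (simp add: perp_plane_def)

lemma linear_twisted_pair: "linear (\<lambda>x. (x, e \<cdot>\<^sub>O x))"
  by (rule linearI) (simp_all add: oct.add_right oct.scaleR_right)

lemma line_in_projectivization_twisted_pairs:
  assumes "line u \<in> projectivization (twisted_pairs e)" "u \<noteq> 0"
  shows "u \<in> twisted_pairs e"
proof -
  obtain w where w: "line u = line w" "w \<in> twisted_pairs e"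
    using assms(1) unfolding projectivization_def by (rule imageE)
  obtain r where r: "u = r *\<^sub>R w" using mem_line_self[of u] w(1) by (auto elim: mem_lineE)
  obtain x where x: "x \<in> perp_plane e" "x \<noteq> 0" "w = (x, e \<cdot>\<^sub>O x)" using w(2) by (rule twisted_pairsE)
  have "r \<noteq> 0" using r assms(2) by (metis scale_zero_left)
  moreover have "u = (r *\<^sub>R x, e \<cdot>\<^sub>O (r *\<^sub>R x))" using r x(3) by (simp add: oct.scaleR_right)
  moreover have "r *\<^sub>R x \<in> perp_plane e" using x(1) by (simp add: perp_plane_def)
  ultimately show ?thesis using x(2) by (metis twisted_pairsI scaleR_eq_0_iff)
qed

lemma right_annihilator_twisted_pairs:
  assumes "imaginary_unit e" "u \<in> twisted_pairs e" "u \<cdot>\<^sub>S v = 0" "v \<noteq> 0"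
  shows "v \<in> twisted_pairs (- e)"
proof -
  interpret imaginary_unit e by fact
  obtain x where x: "x \<in> perp_plane e" "x \<noteq> 0" "u = (x, e \<cdot>\<^sub>O x)"
    using assms(2) by (rule twisted_pairsE)
  have prod: "(x, e \<cdot>\<^sub>O x) \<cdot>\<^sub>S (fst v, snd v) = 0" using assms(3) x(3) by simp
  note p = right_annihilator_twisted[OF x(1,2) prod]
  then have v: "v = (fst v, - e \<cdot>\<^sub>O fst v)" by (simp add: prod_eq_iff oct.minus_left)
  have "fst v \<noteq> 0"
  proof
    assume "fst v = 0"
    then have "v = (0, 0)" using p(4) by (simp only: oct.zero_right fst_conv snd_conv minus_zero simp_thms prod_eq_iff[of v])
    then have "v = 0" by (simp only: zero_prod_def)
    with assms(4) show False by contradiction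
  qed
  with p(1) show ?thesis by (subst v) (intro twisted_pairsI, simp_all)
qed

lemma imaginary_unit_uminus: "imaginary_unit e \<Longrightarrow> imaginary_unit (- e)"
  by (simp add: imaginary_unit_def)

section \<open>The orthogonality graph on twisted pairs\<close>

lemma orthogonality_arc:
  assumes e: "imaginary_unit e" and x: "x \<in> perp_plane e" "x \<noteq> 0" and y: "y \<in> perp_plane e" "y \<noteq> 0"
    and yx: "y \<bullet> x = 0" "y \<bullet> (e \<cdot>\<^sub>O x) = 0"
  shows "(line (x, e \<cdot>\<^sub>O x), line (y, - e \<cdot>\<^sub>O y)) \<in> parcs orthogonality_graph"
proof -
  interpret imaginary_unit e by fact
  interpret m: imaginary_unit "- e" by (rule imaginary_unit_uminus[OF e])
  let ?u = "(x, e \<cdot>\<^sub>O x)" and ?v = "(y, - e \<cdot>\<^sub>O y)"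
  have uv: "?u \<cdot>\<^sub>S ?v = 0"
    using twisted_mult_eq_0[OF x(1) y(1) yx] by (simp add: oct.minus_left)
  have vu: "?v \<cdot>\<^sub>S ?u = 0"
  proof -
    have "x \<bullet> y = 0" "x \<bullet> (- e \<cdot>\<^sub>O y) = 0"
      using yx inner_unit_mult_skew[of x y] by (simp_all add: inner_commute oct.minus_left)
    then show ?thesis
      using m.twisted_mult_eq_0[of y x] x y by (simp add: oct.minus_left)
  qed
  have ne: "line ?u \<noteq> line ?v"
  proof
    assume "line ?u = line ?v"
    then have "?v \<in> line ?u" using mem_line_self[of ?v] by simp
    then obtain r where "?v = r *\<^sub>R ?u" by (rule mem_lineE)
    then have "y = r *\<^sub>R x" by simp
    with yx(1) x(2) y(2) show False by simp
  qed
  have nz: "?u \<noteq> 0" "?v \<noteq> 0"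
    using x y by (simp_all only: zero_prod_def[where 'a = octonion and 'b = octonion] prod.inject simp_thms)
  have "?u \<in> sed_zero_divisors"
    unfolding sed_zero_divisors_def by (intro CollectI conjI exI[of _ ?v] disjI1 nz uv)
  moreover have "?v \<in> sed_zero_divisors"
    unfolding sed_zero_divisors_def by (intro CollectI conjI exI[of _ ?u] disjI1 nz vu)
  ultimately show ?thesis
    unfolding orthogonality_graph_def pair_pre_digraph.simps
    by (intro CollectI exI[of _ ?u] exI[of _ ?v] conjI refl ne uv vu)
qed

text \<open>
  A component is defined as a maximal subgraph that is connected in the undirected sense. For a
  symmetric graph the subgraph induced on all vertices reachable from \<open>v\<close> contains every connected
  subgraph through \<open>v\<close> and is itself connected, so maximality identifies the two.
\<close>

lemma verts_connected_component:
  assumes wf: "wf_digraph G" and sym: "symmetric G"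
    and C: "connected_component G C" and v: "v \<in> verts C"
  shows "verts C = {w. v \<rightarrow>\<^sup>*\<^bsub>G\<^esub> w}"
proof -
  interpret wf_digraph G by (rule wf)
  interpret sym_digraph G using sym by unfold_locales
  let ?D = "G \<restriction> {w. v \<rightarrow>\<^sup>*\<^bsub>G\<^esub> w}"
  have sub: "subgraph C G" and conn: "Digraph_Component.connected C"
    using C by (auto simp: connected_component_def max_subgraph_def)
  have "v \<in> verts G" using sub v by auto
  then have "?D \<in> sccs" by (rule induce_reachable_is_in_sccs)
  then have subD: "subgraph ?D G" and sc: "strongly_connected ?D"
    by (auto simp: sccs_def)
  interpret D: wf_digraph ?D by (rule wellformed_induce_subgraph)
  have connD: "Digraph_Component.connected ?D"
    using sc by (intro D.connectedI) (auto intro!: D.reachable_mk_symmetricI simp: strongly_connected_def)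
  have "verts C \<subseteq> {w. v \<rightarrow>\<^sup>*\<^bsub>G\<^esub> w}"
  proof safe
    fix w assume "w \<in> verts C"
    then have "v \<rightarrow>\<^sup>*\<^bsub>mk_symmetric C\<^esub> w"
      using v conn by (auto simp: Digraph_Component.connected_def strongly_connected_def)
    then have "v \<rightarrow>\<^sup>*\<^bsub>mk_symmetric G\<^esub> w"
      using subgraph_mk_symmetric[OF sub] by (rule pre_digraph.reachable_mono)
    then show "v \<rightarrow>\<^sup>*\<^bsub>G\<^esub> w" using reachable_mk_symmetric_eq[OF sym] by simp
  qed
  then have "subgraph (G \<restriction> verts C) ?D"
    using sub by (auto simp: subgraph_def compatible_def D.wf_digraph_axioms wellformed_induce_subgraph)
  then have "subgraph C ?D"
    using subgraph_induce_subgraphI2[OF sub] subgraph_trans by blast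
  then have "C = ?D"
    using C connD subD unfolding connected_component_def max_subgraph_def by metis
  then show ?thesis by simp
qed

text \<open>
  The generators of both parts of \<open>\<Lambda>\<close> are the images of the same spanning set \<open>a, b, d, c, a c, a d\<close> of
  \<^term>\<open>perp_plane e\<close> under the maps \<open>x \<mapsto> (x, e x)\<close> and \<open>x \<mapsto> (x, - e x)\<close>, up to their order.
\<close>

lemma Lambda_eq_twisted_pairs:
  assumes e: "imaginary_unit e" and a: "a \<in> perp_plane e" "a \<bullet> a = 1" and c: "c \<in> perp_plane e" "c \<bullet> c = 1"
    and ca: "c \<bullet> a = 0" "c \<bullet> (e \<cdot>\<^sub>O a) = 0"
    and b: "b = e \<cdot>\<^sub>O a" and d: "d = - (e \<cdot>\<^sub>O c)"
  shows "Lambda a b c d = twisted_pairs e \<union> twisted_pairs (- e)"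
proof -
  interpret imaginary_unit e by fact
  let ?S = "{a, e \<cdot>\<^sub>O a, c, e \<cdot>\<^sub>O c, a \<cdot>\<^sub>O c, e \<cdot>\<^sub>O (a \<cdot>\<^sub>O c)}"
  have S: "perp_plane e = span ?S" by (rule perp_plane_eq_span[OF a c ca])
  have ad: "a \<cdot>\<^sub>O d = e \<cdot>\<^sub>O (a \<cdot>\<^sub>O c)"
    by (simp add: d oct.minus_right perp_mult_unit[OF a(1)])
  have tw: "twisted_pairs f = lin_star ((\<lambda>x. (x, f \<cdot>\<^sub>O x)) ` T)"
    if "span T = perp_plane f" for f T
  proof -
    have "span ((\<lambda>x. (x, f \<cdot>\<^sub>O x)) ` T) = (\<lambda>x. (x, f \<cdot>\<^sub>O x)) ` perp_plane f"
      using linear_span_image[OF linear_twisted_pair] that by simp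
    moreover have "(\<lambda>x. (x, f \<cdot>\<^sub>O x)) ` perp_plane f - {0} = (\<lambda>x. (x, f \<cdot>\<^sub>O x)) ` (perp_plane f - {0})"
    proof -
      have "inj (\<lambda>x. (x, f \<cdot>\<^sub>O x))" by (rule injI) simp
      then show ?thesis by (simp add: image_set_diff oct.zero_right zero_prod_def[symmetric])
    qed
    ultimately show ?thesis by (simp add: lin_star_def twisted_pairs_def)
  qed
  let ?T = "{a, b, d, c, a \<cdot>\<^sub>O c, a \<cdot>\<^sub>O d}"
  have T: "span ?T = perp_plane e"
  proof -
    have "span ?T \<subseteq> span ?S"
      unfolding b ad unfolding d by (intro span_minimal) (auto intro: span_base span_neg)
    moreover have "e \<cdot>\<^sub>O c = - d" by (simp add: d)
    then have "span ?S \<subseteq> span ?T"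
      unfolding ad[symmetric] b[symmetric] by (intro span_minimal) (auto intro: span_base span_neg)
    ultimately show ?thesis using S by auto
  qed
  have gens: "e \<cdot>\<^sub>O b = - a" "e \<cdot>\<^sub>O c = - d" "e \<cdot>\<^sub>O d = c" "e \<cdot>\<^sub>O (a \<cdot>\<^sub>O c) = a \<cdot>\<^sub>O d"
    "e \<cdot>\<^sub>O (a \<cdot>\<^sub>O d) = - (a \<cdot>\<^sub>O c)"
    by (simp_all only: ad) (simp_all add: b d oct.minus_right unit_mult_unit_mult)
  have "Lambda_plus a b c d = lin_star ((\<lambda>x. (x, e \<cdot>\<^sub>O x)) ` ?T)"
    unfolding Lambda_plus_def
    by (simp add: gens b[symmetric])
  moreover have "Lambda_minus a b c d = lin_star ((\<lambda>x. (x, - e \<cdot>\<^sub>O x)) ` ?T)"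
    unfolding Lambda_minus_def
    by (simp add: gens b[symmetric] oct.minus_left insert_commute)
  ultimately show ?thesis
    using tw[of ?T e] tw[of ?T "- e"] T by (simp add: Lambda_def)
qed

text \<open>
  An arc goes from \<open>(x, e x)\<close> to \<open>(z, - e z)\<close> whenever \<open>x\<close> and \<open>z\<close> are nonzero and orthogonal in the
  Hermitian sense. Two vectors have a common orthogonal vector, which connects any two lines of the same sign in two
  steps; a third step reaches the lines of the other sign.
\<close>

lemma reachable_twisted_pairs:
  assumes e: "imaginary_unit e" and x: "x \<in> perp_plane e" "x \<noteq> 0"
    and w: "w \<in> twisted_pairs e \<union> twisted_pairs (- e)"
  shows "line (x, e \<cdot>\<^sub>O x) \<rightarrow>\<^sup>*\<^bsub>orthogonality_graph\<^esub> line w"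
proof -
  interpret G: wf_digraph "with_proj orthogonality_graph" by (rule wf_orthogonality_graph)
  have step: "line (x, f \<cdot>\<^sub>O x) \<rightarrow>\<^sup>*\<^bsub>orthogonality_graph\<^esub> line (y, - f \<cdot>\<^sub>O y)"
    if "imaginary_unit f" "x \<in> perp_plane f" "x \<noteq> 0" "y \<in> perp_plane f" "y \<noteq> 0"
      "y \<bullet> x = 0" "y \<bullet> (f \<cdot>\<^sub>O x) = 0" for f x y
    by (rule G.reachable_adjI) (use orthogonality_arc[OF that] in simp)
  interpret imaginary_unit e by fact
  have two_steps: "line (x, e \<cdot>\<^sub>O x) \<rightarrow>\<^sup>*\<^bsub>orthogonality_graph\<^esub> line (y, e \<cdot>\<^sub>O y)"
    if y: "y \<in> perp_plane e" "y \<noteq> 0" for y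
  proof -
    obtain z where z: "z \<in> perp_plane e" "z \<noteq> 0" "z \<bullet> x = 0" "z \<bullet> (e \<cdot>\<^sub>O x) = 0"
      "z \<bullet> y = 0" "z \<bullet> (e \<cdot>\<^sub>O y) = 0" by (rule perp_exists)
    have "line (x, e \<cdot>\<^sub>O x) \<rightarrow>\<^sup>*\<^bsub>orthogonality_graph\<^esub> line (z, - e \<cdot>\<^sub>O z)"
      by (rule step[OF e x z(1-4)])
    also have "line (z, - e \<cdot>\<^sub>O z) \<rightarrow>\<^sup>*\<^bsub>orthogonality_graph\<^esub> line (y, - (- e) \<cdot>\<^sub>O y)"
      using z y imaginary_unit_uminus[OF e] inner_unit_mult_skew[of y z]
      by (intro step) (simp_all add: inner_commute oct.minus_left)
    finally show ?thesis by simp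
  qed
  show ?thesis
  proof (cases "w \<in> twisted_pairs e")
    case True
    then obtain y where "y \<in> perp_plane e" "y \<noteq> 0" "w = (y, e \<cdot>\<^sub>O y)" by (rule twisted_pairsE)
    then show ?thesis using two_steps by simp
  next
    case False
    then have "w \<in> twisted_pairs (- e)" using w by simp
    then obtain y where y: "y \<in> perp_plane e" "y \<noteq> 0" "w = (y, - e \<cdot>\<^sub>O y)"
      unfolding perp_plane_uminus[of e, symmetric] by (rule twisted_pairsE)
    obtain z where z: "z \<in> perp_plane e" "z \<noteq> 0" "z \<bullet> y = 0" "z \<bullet> (e \<cdot>\<^sub>O y) = 0" by (rule perp_exists)
    have "line (x, e \<cdot>\<^sub>O x) \<rightarrow>\<^sup>*\<^bsub>orthogonality_graph\<^esub> line (z, e \<cdot>\<^sub>O z)"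
      by (rule two_steps[OF z(1,2)])
    also have "\<dots> \<rightarrow>\<^sup>*\<^bsub>orthogonality_graph\<^esub> line w"
      using z inner_unit_mult_skew[of y z] unfolding y(3)
      by (intro step e y) (simp_all add: inner_commute)
    finally show ?thesis .
  qed
qed

text \<open>
  Annihilation leads from the pairs for \<open>e\<close> to those for \<open>- e\<close> and back, so the union of the two sets
  is closed under adjacency.
\<close>

lemma reachable_imp_twisted_pairs:
  assumes e: "imaginary_unit e"
    and "v \<rightarrow>\<^sup>*\<^bsub>orthogonality_graph\<^esub> w" "v \<in> projectivization (twisted_pairs e \<union> twisted_pairs (- e))"
  shows "w \<in> projectivization (twisted_pairs e \<union> twisted_pairs (- e))"
  using assms(2)
proof (induction rule: wf_digraph.reachable_induct[OF wf_orthogonality_graph, consumes 1, case_names base step])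
  case base
  show ?case by (rule assms(3))
next
  case (step v' w')
  have "(v', w') \<in> parcs orthogonality_graph" using step(2) by simp
  then obtain u t where *: "(v', w') = (line u, line t) \<and> u \<in> sed_zero_divisors \<and>
      t \<in> sed_zero_divisors \<and> line u \<noteq> line t \<and> u \<cdot>\<^sub>S t = 0 \<and> t \<cdot>\<^sub>S u = 0"
    unfolding orthogonality_graph_def pair_pre_digraph.simps mem_Collect_eq by (elim exE)
  have "w \<noteq> 0" if "w \<in> sed_zero_divisors" for w
    using that unfolding sed_zero_divisors_def mem_Collect_eq by (rule conjunct1)
  with * have ut: "v' = line u" "w' = line t" "u \<noteq> 0" "t \<noteq> 0" "u \<cdot>\<^sub>S t = 0"
    by (simp_all only: prod.inject simp_thms)
  have "line u \<in> projectivization (twisted_pairs e) \<or> line u \<in> projectivization (twisted_pairs (- e))"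
    using step(3) unfolding ut(1) projectivization_def image_Un Un_iff .
  then have "u \<in> twisted_pairs e \<or> u \<in> twisted_pairs (- e)"
    using line_in_projectivization_twisted_pairs ut(3) by metis
  then have "t \<in> twisted_pairs e \<union> twisted_pairs (- e)"
    using right_annihilator_twisted_pairs[OF e _ ut(5,4)]
      right_annihilator_twisted_pairs[OF imaginary_unit_uminus[OF e] _ ut(5,4)]
    by (elim disjE) simp_all
  then show ?case unfolding ut(2) by (rule line_in_projectivization)
qed

theorem corollary4p10:
  fixes a b c d :: octonion
    and C :: "(sedenion set, sedenion set \<times> sedenion set) pre_digraph"
  assumes "(a, b) \<in> sed_zero_divisors" and "(c, d) \<in> sed_zero_divisors"
    and "(a, b) \<cdot>\<^sub>S (c, d) = 0"
    and "oct_norm a = 1" and "oct_norm b = 1" and "oct_norm c = 1" and "oct_norm d = 1"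
    and "connected_component (with_proj orthogonality_graph) C"
    and "line (a, b) \<in> verts C"
  shows "verts C = projectivization (Lambda a b c d)"
proof -
  have aa: "a \<bullet> a = 1" and bb: "b \<bullet> b = 1" and cc: "c \<bullet> c = 1"
    using assms by (simp_all add: oct_norm_eq_inner)
  then have nz: "a \<noteq> 0" "c \<noteq> 0" by auto
  have im: "a \<bullet> \<one>\<^sub>O = 0" "b \<bullet> \<one>\<^sub>O = 0" "a \<bullet> b = 0"
    using sed_zero_divisor_imaginary_orthogonal[OF assms(3)] aa bb nz by auto
  \<comment> \<open>As \<open>a\<close> has norm one, its conjugate is its inverse.\<close>
  define e where "e = b \<cdot>\<^sub>O oct_cnj a"
  have e_ba: "e = - (b \<cdot>\<^sub>O a)" using im by (simp add: e_def oct_cnj_imaginary oct.minus_right)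
  have ea: "b = e \<cdot>\<^sub>O a"
    using oct_imaginary_square_right[OF im(1), of b] by (simp add: e_ba aa oct.minus_left)
  have e: "imaginary_unit e"
  proof
    show "e \<bullet> \<one>\<^sub>O = 0"
      using oct_mult_adjoint_right[of b "oct_cnj a" "\<one>\<^sub>O"] im(3) by (simp add: e_def oct_one inner_commute[of b a])
    show "e \<bullet> e = 1"
      using inner_oct_mult_right[of b a b] by (simp add: e_ba aa bb)
  qed
  have "e \<bullet> a = 0"
    using inner_oct_mult_right[of b a "\<one>\<^sub>O"] by (simp add: e_ba im oct_one)
  then have a: "a \<in> perp_plane e" using im by (simp add: perp_plane_def inner_commute)
  note c = imaginary_unit.right_annihilator_twisted[OF e a nz(1) assms(3)[unfolded ea]]
  have L: "Lambda a b c d = twisted_pairs e \<union> twisted_pairs (- e)"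
    by (rule Lambda_eq_twisted_pairs[OF e a aa c(1) cc c(2,3) ea c(4)])
  have "verts C = {w. line (a, b) \<rightarrow>\<^sup>*\<^bsub>orthogonality_graph\<^esub> w}"
    by (rule verts_connected_component[OF wf_orthogonality_graph symmetric_orthogonality_graph assms(8,9)])
  also have "\<dots> = projectivization (twisted_pairs e \<union> twisted_pairs (- e))"
  proof safe
    have "line (a, b) \<in> projectivization (twisted_pairs e \<union> twisted_pairs (- e))"
      unfolding ea by (intro line_in_projectivization UnI1 twisted_pairsI a nz)
    then show "w \<in> projectivization (twisted_pairs e \<union> twisted_pairs (- e))"
      if "line (a, b) \<rightarrow>\<^sup>*\<^bsub>orthogonality_graph\<^esub> w" for w
      using reachable_imp_twisted_pairs[OF e that] by simp
    show "line (a, b) \<rightarrow>\<^sup>*\<^bsub>orthogonality_graph\<^esub> w"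
      if "w \<in> projectivization (twisted_pairs e \<union> twisted_pairs (- e))" for w
      using that unfolding projectivization_def ea
      by (rule imageE) (simp only: reachable_twisted_pairs[OF e a nz(1)])
  qed
  finally show ?thesis by (simp add: L)
qed

end
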